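(* Let $G$ be a set and let $k,\ell\ge 1$ be integers. For every $\vec r=(r_1,\dots,r_k)\in\mathbb Z_{\ge1}^k$, $\vec a\in G^k$, $\vec s=(s_1,\dots,s_\ell)\in\mathbb Z_{\ge1}^\ell$, $\vec b\in G^\ell$, the following identity holds in $(\mathcal H(\mathbb Z_{\ge1}\times G),\sqcup\!\sqcup_\rho)$: $$\binom{\vec r}{\vec a}\sqcup\!\sqcup_\rho\binom{\vec s}{\vec b}=\sum_{(\varphi,\psi)\in I_{k,\ell}}\ \sum_{\substack{\vec t\in\mathbb Z_{\ge1}^{k+\ell}\\ |\vec t|=|\vec r|+|\vec s|}} c_{\vec r,\vec s}^{\vec t,(\varphi,\psi)}\binom{\vec t}{\vec a\sqcup\!\sqcup_{(\varphi,\psi)}\vec b}.$$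
   Context: Words and the algebra: for a set $G$, an element of the free monoid on $\mathbb Z_{\ge1}\times G$ is written $\binom{s_1,\dots,s_k}{b_1,\dots,b_k}=\binom{\vec s}{\vec b}$ (the word $(s_1,b_1)\cdots(s_k,b_k)$); the empty word is $1$. $\mathcal H(\mathbb Z_{\ge1}\times G)$ is the free abelian group with these words as basis. Let $x_0$ and $x_b$ ($b\in G$) be pairwise distinct letters (indexed by the disjoint union $\{0\}\sqcup G$), and let $\sqcup\!\sqcup$ be the shuffle product on the free abelian group on words in these letters, defined by $1\sqcup\!\sqcup w=w\sqcup\!\sqcup 1=w$ and $(a_1u)\sqcup\!\sqcup(b_1v)=a_1(u\sqcup\!\sqcup b_1v)+b_1(a_1u\sqcup\!\sqcup v)$ for letters $a_1,b_1$ and words $u,v$. The span $\mathcal H_1$ of $1$ and of the words ending in some $x_b$, $b\in G$, is closed under $\sqcup\!\sqcup$, and the words $x_0^{s_1-1}x_{b_1}\cdots x_0^{s_k-1}x_{b_k}$ ($s_i\ge1$, $b_i\in G$, $k\ge1$) together with $1$ form a basis of it. Let $\rho:\mathcal H_1\to\mathcal H(\mathbb Z_{\ge1}\times G)$ be the linear bijection $x_0^{s_1-1}x_{b_1}\cdots x_0^{s_k-1}x_{b_k}\mapsto\binom{s_1,\dots,s_k}{b_1,\dots,b_k}$, $1\mapsto 1$, and define $u\sqcup\!\sqcup_\rho v=\rho(\rho^{-1}(u)\sqcup\!\sqcup\rho^{-1}(v))$. Coefficients: $[k]=\{1,\dots,k\}$. $I_{k,\ell}$ is the set of pairs $(\varphi,\psi)$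 of order-preserving injective maps $\varphi:[k]\to[k+\ell]$, $\psi:[\ell]\to[k+\ell]$ with $\mathrm{im}\,\varphi\sqcup\mathrm{im}\,\psi=[k+\ell]$. For $\vec a\in G^k,\vec b\in G^\ell$, $\vec a\sqcup\!\sqcup_{(\varphi,\psi)}\vec b\in G^{k+\ell}$ has $i$-th entry $a_j$ if $i=\varphi(j)$ and $b_j$ if $i=\psi(j)$. $|\vec x|$ denotes the sum of the entries. For $\vec t\in\mathbb Z_{\ge1}^{k+\ell}$ with $|\vec t|=|\vec r|+|\vec s|$ and $(\varphi,\psi)\in I_{k,\ell}$, put $h_i=r_j$ if $i=\varphi(j)$ and $h_i=s_j$ if $i=\psi(j)$, and $\varepsilon(i)=1$ if $i\in\mathrm{im}\,\varphi$, $\varepsilon(i)=-1$ if $i\in\mathrm{im}\,\psi$. Define $c(i)=\binom{t_i-1}{h_i-1}$ if $i=1$ or if $i\ge2$ and $\varepsilon(i)=\varepsilon(i-1)$; and $c(i)=\binom{t_i-1}{\sum_{j=1}^i t_j-\sum_{j=1}^i h_j}$ if $i\ge2$ and $\varepsilon(i)\ne\varepsilon(i-1)$. Here for integers $a\ge0$ and $b$, $\binom{a}{b}$ is the usual binomial coefficient if $0\le b\le a$ and $0$ otherwise. Finally $c_{\vec r,\vec s}^{\vec t,(\varphi,\psi)}=\prod_{i=1}^{k+\ell}c(i)$. *)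

theory Defs
  imports "HOL-Algebra.Free_Abelian_Groups" "HOL-Library.FuncSet"
begin

text \<open>
  Elements of the free abelian group on a set of words are finitely supported integer-valued
  functions on lists, as in \<^const>\<open>free_Abelian_group\<close>; \<^const>\<open>frag_of\<close> embeds the basis and
  \<^const>\<open>frag_extend\<close> is linear extension.
\<close>

definition sH_words :: "'g set \<Rightarrow> (nat \<times> 'g) list set" where
  "sH_words G = lists ({1..} \<times> G)"

definition sH :: "'g set \<Rightarrow> ((nat \<times> 'g) list \<Rightarrow>\<^sub>0 int) set" where
  "sH G = carrier (free_Abelian_group (sH_words G))"

text \<open>The letter \<open>x\<^sub>0\<close> is \<^const>\<open>None\<close> and \<open>x\<^sub>b\<close> is \<open>Some b\<close>.\<close>

definition H1_words :: "'g set \<Rightarrow> 'g option list set" where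
  "H1_words G = {w \<in> lists (insert None (Some ` G)). w = [] \<or> (\<exists>b\<in>G. last w = Some b)}"

definition H1 :: "'g set \<Rightarrow> ('g option list \<Rightarrow>\<^sub>0 int) set" where
  "H1 G = carrier (free_Abelian_group (H1_words G))"

fun shuffle_words :: "'x list \<Rightarrow> 'x list \<Rightarrow> ('x list \<Rightarrow>\<^sub>0 int)" where
  "shuffle_words [] w = frag_of w"
| "shuffle_words w [] = frag_of w"
| "shuffle_words (a # u) (b # v) =
     frag_extend (\<lambda>w. frag_of (a # w)) (shuffle_words u (b # v)) +
     frag_extend (\<lambda>w. frag_of (b # w)) (shuffle_words (a # u) v)"

definition shuffle_prod ::
    "('x list \<Rightarrow>\<^sub>0 int) \<Rightarrow> ('x list \<Rightarrow>\<^sub>0 int) \<Rightarrow> ('x list \<Rightarrow>\<^sub>0 int)" where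
  "shuffle_prod p q = frag_extend (\<lambda>u. frag_extend (\<lambda>v. shuffle_words u v) q) p"

definition xword :: "(nat \<times> 'g) list \<Rightarrow> 'g option list" where
  "xword w = concat (map (\<lambda>(s, b). replicate (s - 1) None @ [Some b]) w)"

text \<open>
  The linear map sending \<open>xword w\<close> to \<open>w\<close>; see \<open>rho_xword\<close> and \<open>bij_betw_rho\<close> below.
\<close>

definition rho :: "'g set \<Rightarrow> ('g option list \<Rightarrow>\<^sub>0 int) \<Rightarrow> ((nat \<times> 'g) list \<Rightarrow>\<^sub>0 int)" where
  "rho G = frag_extend (\<lambda>u. frag_of (the_inv_into (sH_words G) xword u))"

definition shuffle_rho :: "'g set \<Rightarrow> ((nat \<times> 'g) list \<Rightarrow>\<^sub>0 int) \<Rightarrow> ((nat \<times> 'g) list \<Rightarrow>\<^sub>0 int)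
    \<Rightarrow> ((nat \<times> 'g) list \<Rightarrow>\<^sub>0 int)" where
  "shuffle_rho G u v =
     rho G (shuffle_prod (the_inv_into (H1 G) (rho G) u) (the_inv_into (H1 G) (rho G) v))"

text \<open>
  Vectors of length \<open>n\<close> are functions on \<open>{1..n}\<close>. Where a set of vectors or maps is summed over,
  they are extensional, so that each is counted once.
\<close>

definition word :: "nat \<Rightarrow> (nat \<Rightarrow> nat) \<Rightarrow> (nat \<Rightarrow> 'g) \<Rightarrow> (nat \<times> 'g) list" where
  "word n s b = map (\<lambda>i. (s i, b i)) [1..<n+1]"

definition I_set :: "nat \<Rightarrow> nat \<Rightarrow> ((nat \<Rightarrow> nat) \<times> (nat \<Rightarrow> nat)) set" where
  "I_set k l = {(\<phi>, \<psi>).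
     \<phi> \<in> {1..k} \<rightarrow>\<^sub>E {1..k+l} \<and> mono_on {1..k} \<phi> \<and> inj_on \<phi> {1..k} \<and>
     \<psi> \<in> {1..l} \<rightarrow>\<^sub>E {1..k+l} \<and> mono_on {1..l} \<psi> \<and> inj_on \<psi> {1..l} \<and>
     \<phi> ` {1..k} \<inter> \<psi> ` {1..l} = {} \<and> \<phi> ` {1..k} \<union> \<psi> ` {1..l} = {1..k+l}}"

definition merge_vec :: "nat \<Rightarrow> nat \<Rightarrow> (nat \<Rightarrow> nat) \<times> (nat \<Rightarrow> nat) \<Rightarrow>
    (nat \<Rightarrow> 'x) \<Rightarrow> (nat \<Rightarrow> 'x) \<Rightarrow> nat \<Rightarrow> 'x" where
  "merge_vec k l = (\<lambda>(\<phi>, \<psi>) a b i.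
     if i \<in> \<phi> ` {1..k} then a (the_inv_into {1..k} \<phi> i) else b (the_inv_into {1..l} \<psi> i))"

definition weight_set :: "nat \<Rightarrow> nat \<Rightarrow> (nat \<Rightarrow> nat) set" where
  "weight_set n m = {t \<in> {1..n} \<rightarrow>\<^sub>E {1..}. (\<Sum>i=1..n. t i) = m}"

definition binom :: "int \<Rightarrow> int \<Rightarrow> int" where
  "binom a b = (if 0 \<le> b \<and> b \<le> a then int (nat a choose nat b) else 0)"

definition eps :: "nat \<Rightarrow> (nat \<Rightarrow> nat) \<times> (nat \<Rightarrow> nat) \<Rightarrow> nat \<Rightarrow> int" where
  "eps k = (\<lambda>(\<phi>, \<psi>) i. if i \<in> \<phi> ` {1..k} then 1 else -1)"

definition coeff_factor :: "nat \<Rightarrow> nat \<Rightarrow> (nat \<Rightarrow> nat) \<Rightarrow> (nat \<Rightarrow> nat) \<Rightarrow> (nat \<Rightarrow> nat) \<Rightarrow>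
    (nat \<Rightarrow> nat) \<times> (nat \<Rightarrow> nat) \<Rightarrow> nat \<Rightarrow> int" where
  "coeff_factor k l r s t \<phi>\<psi> i =
     (let h = merge_vec k l \<phi>\<psi> r s in
      if i = 1 \<or> (i \<ge> 2 \<and> eps k \<phi>\<psi> i = eps k \<phi>\<psi> (i - 1))
      then binom (int (t i) - 1) (int (h i) - 1)
      else binom (int (t i) - 1) ((\<Sum>j=1..i. int (t j)) - (\<Sum>j=1..i. int (h j))))"

definition shuffle_coeff :: "nat \<Rightarrow> nat \<Rightarrow> (nat \<Rightarrow> nat) \<Rightarrow> (nat \<Rightarrow> nat) \<Rightarrow> (nat \<Rightarrow> nat) \<Rightarrow>
    (nat \<Rightarrow> nat) \<times> (nat \<Rightarrow> nat) \<Rightarrow> int" where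
  "shuffle_coeff k l r s t \<phi>\<psi> = (\<Prod>i=1..k+l. coeff_factor k l r s t \<phi>\<psi> i)"


lemma xword_Nil [simp]: "xword [] = []"
  and xword_Cons [simp]: "xword ((s, b) # w) = replicate (s - 1) None @ Some b # xword w"
  by (simp_all add: xword_def)

lemma replicate_None_eqD:
  "replicate m None @ Some b # u = replicate n None @ Some c # v \<Longrightarrow> m = n \<and> b = c \<and> u = v"
proof (induction m arbitrary: n)
  case 0
  then show ?case by (cases n) auto
next
  case (Suc m)
  then show ?case by (cases n) auto
qed

lemma xword_inj: "inj_on xword (sH_words G)"
proof (rule inj_onI)
  fix v w assume "v \<in> sH_words G" "w \<in> sH_words G" "xword v = xword w"
  then show "v = w"
  proof (induction v arbitrary: w)
    case Nil
    then show ?case by (cases w) auto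
  next
    case (Cons x v)
    then obtain y w' where w: "w = y # w'" by (cases w; cases x) auto
    obtain s b s' b' where xy: "x = (s, b)" "y = (s', b')" by (cases x, cases y) auto
    have "s - 1 = s' - 1" "b = b'" "xword v = xword w'"
      using replicate_None_eqD[OF Cons.prems(3)[unfolded w xy xword_Cons]] by auto
    with Cons show ?case by (auto simp: w xy sH_words_def)
  qed
qed

lemma xword_in_H1_words: "w \<in> sH_words G \<Longrightarrow> xword w \<in> H1_words G"
proof (induction w)
  case Nil
  then show ?case by (simp add: H1_words_def)
next
  case (Cons x w)
  then show ?case by (cases x) (auto simp: H1_words_def sH_words_def)
qed

lemma xword_surj: "u \<in> H1_words G \<Longrightarrow> u \<in> xword ` sH_words G"
proof (induction u)
  case Nil
  then show ?case by (auto simp: sH_words_def image_iff intro!: bexI[of _ "[]"])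
next
  case (Cons x u)
  from Cons.prems have "u \<in> H1_words G"
    by (auto simp: H1_words_def split: if_splits)
  with Cons.IH obtain w where w: "w \<in> sH_words G" "u = xword w" by auto
  show ?case
  proof (cases x)
    case None
    with Cons.prems have "u \<noteq> []" by (auto simp: H1_words_def)
    with w obtain s b w' where w': "w = (s, b) # w'" by (cases w) auto
    then have "x # u = xword ((Suc s, b) # w')" "(Suc s, b) # w' \<in> sH_words G"
      using w None by (auto simp: sH_words_def simp flip: replicate_Suc append_Cons)
    then show ?thesis by blast
  next
    case (Some b)
    then have "x # u = xword ((1, b) # w)" "(1, b) # w \<in> sH_words G"
      using w Cons.prems by (auto simp: sH_words_def H1_words_def)
    then show ?thesis by blast
  qed
qed

lemma bij_betw_xword: "bij_betw xword (sH_words G) (H1_words G)"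
  using xword_inj xword_in_H1_words xword_surj unfolding bij_betw_def by blast

lemma rho_xword: "w \<in> sH_words G \<Longrightarrow> rho G (frag_of (xword w)) = frag_of w"
  by (simp add: rho_def the_inv_into_f_f[OF xword_inj])

lemma bij_betw_rho: "bij_betw (rho G) (H1 G) (sH G)"
proof -
  define d where "d = the_inv_into (sH_words G) xword"
  define e where "e = frag_extend (frag_of \<circ> (xword :: (nat \<times> 'a) list \<Rightarrow> _))"
  have d: "d u \<in> sH_words G" "xword (d u) = u" if "u \<in> H1_words G" for u
    using that bij_betw_xword[of G] unfolding d_def bij_betw_def
    by (auto intro: the_inv_into_into f_the_inv_into_f)
  have d': "d (xword w) = w" if "w \<in> sH_words G" for w
    using that by (simp add: d_def the_inv_into_f_f[OF xword_inj])
  have rho: "rho G = frag_extend (frag_of \<circ> d)"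
    by (simp add: rho_def d_def comp_def)
  have ext_id: "frag_extend f p = p" if "\<And>x. x \<in> Poly_Mapping.keys p \<Longrightarrow> f x = frag_of x"
    for f and p :: "'x \<Rightarrow>\<^sub>0 int"
    using that by (subst (2) frag_expansion) (rule frag_extend_eq)
  show ?thesis
  proof (rule bij_betw_byWitness[where f' = e])
    show "\<forall>p\<in>H1 G. e (rho G p) = p"
      by (auto simp: e_def rho H1_def frag_extend_compose d subset_iff intro!: ext_id)
    show "\<forall>p\<in>sH G. rho G (e p) = p"
      by (auto simp: e_def rho sH_def frag_extend_compose d' subset_iff intro!: ext_id)
    show "rho G ` H1 G \<subseteq> sH G"
      using d(1) by (auto simp: rho H1_def sH_def subset_iff dest!: subsetD[OF keys_frag_extend])
    show "e ` sH G \<subseteq> H1 G"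
      using xword_in_H1_words[of _ G]
      by (auto simp: e_def H1_def sH_def subset_iff dest!: subsetD[OF keys_frag_extend])
  qed
qed

lemma keys_shuffle_words:
  assumes "u \<in> H1_words G" "v \<in> H1_words G"
  shows "Poly_Mapping.keys (shuffle_words u v) \<subseteq> H1_words G"
proof -
  have tl: "u \<in> H1_words G" if "x # u \<in> H1_words G" for x u
    using that by (auto simp: H1_words_def split: if_splits)
  have cons: "x # w \<in> H1_words G" if "x # u \<in> H1_words G" "w \<in> H1_words G" "w \<noteq> []" for x u w
    using that by (auto simp: H1_words_def)
  have nonempty: "[] \<notin> Poly_Mapping.keys (shuffle_words u v)" if "u \<noteq> [] \<or> v \<noteq> []"
    for u v :: "'a option list"
    using that
  proof (induction u v rule: shuffle_words.induct)
    case (3 a u b v)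
    then show ?case
      by (auto dest!: subsetD[OF keys_add] subsetD[OF keys_frag_extend])
  qed auto
  show ?thesis
    using assms
  proof (induction u v rule: shuffle_words.induct)
    case (3 a u b v)
    have *: "Poly_Mapping.keys (frag_extend (\<lambda>w. frag_of (x # w)) p) \<subseteq> H1_words G"
      if "Poly_Mapping.keys p \<subseteq> H1_words G" "[] \<notin> Poly_Mapping.keys p" "x # y \<in> H1_words G" for x y p
    proof
      fix z assume "z \<in> Poly_Mapping.keys (frag_extend (\<lambda>w. frag_of (x # w)) p)"
      then obtain w where "w \<in> Poly_Mapping.keys p" "z = x # w"
        by (auto dest!: subsetD[OF keys_frag_extend])
      then show "z \<in> H1_words G" using that cons by blast
    qed
    have "Poly_Mapping.keys (shuffle_words u (b # v)) \<subseteq> H1_words G"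
      "Poly_Mapping.keys (shuffle_words (a # u) v) \<subseteq> H1_words G"
      using 3 tl by blast+
    then show ?case
      unfolding shuffle_words.simps
      by (intro order_trans[OF keys_add] Un_least *[OF _ _ 3(3)] *[OF _ _ 3(4)])
        (simp_all add: nonempty)
  qed auto
qed

lemma shuffle_prod_closed:
  assumes "p \<in> H1 G" "q \<in> H1 G"
  shows "shuffle_prod p q \<in> H1 G"
proof -
  have "w \<in> H1_words G" if w: "w \<in> Poly_Mapping.keys (shuffle_prod p q)" for w
  proof -
    obtain u where "u \<in> Poly_Mapping.keys p"
      "w \<in> Poly_Mapping.keys (frag_extend (\<lambda>v. shuffle_words u v) q)"
      using subsetD[OF keys_frag_extend w[unfolded shuffle_prod_def]] by blast
    moreover from this(2) obtain v where "v \<in> Poly_Mapping.keys q"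
      "w \<in> Poly_Mapping.keys (shuffle_words u v)"
      using keys_frag_extend[of "\<lambda>v. shuffle_words u v" q] by blast
    ultimately show ?thesis
      using assms keys_shuffle_words[of u G v] by (auto simp: H1_def)
  qed
  then show ?thesis by (auto simp: H1_def)
qed

lemma finite_I_set: "finite (I_set k l)"
  by (rule finite_subset[of _ "({1..k} \<rightarrow>\<^sub>E {1..k+l}) \<times> ({1..l} \<rightarrow>\<^sub>E {1..k+l})"])
    (auto simp only: I_set_def intro!: finite_PiE finite_cartesian_product finite_atLeastAtMost)

lemma finite_weight_set: "finite (weight_set n m)"
proof (rule finite_subset)
  show "weight_set n m \<subseteq> {1..n} \<rightarrow>\<^sub>E {..m}"
  proof
    fix t assume t: "t \<in> weight_set n m"
    have "t i \<le> m" if "i \<in> {1..n}" for i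
      using t that member_le_sum[of i "{1..n}" t] by (auto simp: weight_set_def)
    with t show "t \<in> {1..n} \<rightarrow>\<^sub>E {..m}" by (auto simp: weight_set_def PiE_iff)
  qed
qed (intro finite_PiE finite_atLeastAtMost finite_atMost)

end

theory Submission
  imports Defs "HOL-Library.Infinite_Set"
begin

text \<open>
  In a shuffle of \<open>x\<^sub>0\<^bsup>m\<^esup> x\<^sub>a u\<close> with \<open>x\<^sub>0\<^bsup>n\<^esup> x\<^sub>b v\<close>, either \<open>x\<^sub>a\<close> or \<open>x\<^sub>b\<close> comes first. If it is \<open>x\<^sub>a\<close>,
  preceded by \<open>m + j\<close> letters \<open>x\<^sub>0\<close>, then \<open>j\<close> of these come from the second word, which can happen in
  \<open>m + j choose m\<close> ways, and what follows is a shuffle of \<open>u\<close> with \<open>x\<^sub>0\<^bsup>n - j\<^esup> x\<^sub>b v\<close>. Iterating this writes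
  the product as a sum over interleaving patterns and block lengths \<open>t\<close>, whose coefficients are
  products of binomial coefficients \<open>t\<^sub>i - 1 choose h'\<^sub>i - 1\<close>, where \<open>h'\<^sub>i\<close> is what remains of the
  \<open>i\<close>-th block. If the preceding letter came from the same word, the block is untouched and
  \<open>h'\<^sub>i = h\<^sub>i\<close>; otherwise the letters already taken from it number
  \<open>(t\<^sub>1 + \<dots> + t\<^bsub>i-1\<^esub>) - (h\<^sub>1 + \<dots> + h\<^bsub>i-1\<^esub>)\<close>, and the symmetry of binomial coefficients gives the stated
  factor.
\<close>


subsection \<open>Shuffles of words with initial runs of a letter\<close>

lemma binom_of_nat: "binom (int m) (int n) = int (m choose n)"
  by (auto simp: binom_def)

lemma binom_symmetric: "0 \<le> n \<Longrightarrow> binom n m = binom n (n - m)"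
  by (auto simp: binom_def nat_diff_distrib binomial_symmetric[of "nat m" "nat n"])

definition prepend :: "'x list \<Rightarrow> ('x list \<Rightarrow>\<^sub>0 int) \<Rightarrow> ('x list \<Rightarrow>\<^sub>0 int)" where
  "prepend u = frag_extend (\<lambda>w. frag_of (u @ w))"

lemma prepend_simps [simp]:
  "prepend u 0 = 0"
  "prepend u (p + q) = prepend u p + prepend u q"
  "prepend u (frag_cmul c p) = frag_cmul c (prepend u p)"
  "prepend u (frag_of w) = frag_of (u @ w)"
  by (simp_all add: prepend_def frag_extend_add frag_extend_cmul)

lemma prepend_sum: "finite I \<Longrightarrow> prepend u (\<Sum>i\<in>I. f i) = (\<Sum>i\<in>I. prepend u (f i))"
  by (simp add: prepend_def frag_extend_sum o_def)

lemma prepend_prepend [simp]: "prepend u (prepend v p) = prepend (u @ v) p"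
  unfolding prepend_def by (subst frag_extend_compose[of _ "\<lambda>w. v @ w", unfolded o_def]) simp

lemma shuffle_words_Nil_right [simp]: "shuffle_words w [] = frag_of w"
  by (cases w) auto

lemma shuffle_words_Cons_Cons:
  "shuffle_words (a # u) (b # v) =
     prepend [a] (shuffle_words u (b # v)) + prepend [b] (shuffle_words (a # u) v)"
  by (simp add: prepend_def)

declare shuffle_words.simps(3) [simp del]

text \<open>Contribution of those shuffles in which the letter closing the run
  \<open>replicate m z\<close> precedes the one closing \<open>replicate n z\<close>:
  \<open>j\<close> letters of the second run come before it, and \<open>f\<close> receives the
  number that remains.\<close>

definition block_sum :: "'x \<Rightarrow> (nat \<Rightarrow> ('x list \<Rightarrow>\<^sub>0 int)) \<Rightarrow> nat \<Rightarrow> nat \<Rightarrow> ('x list \<Rightarrow>\<^sub>0 int)" where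
  "block_sum z f m n =
     (\<Sum>j\<le>n. frag_cmul (int (m + j choose m)) (prepend (replicate (m + j) z) (f (n - j))))"

lemma block_sum_0_right: "block_sum z f (Suc m) 0 = prepend [z] (block_sum z f m 0)"
  by (simp add: block_sum_def)

text \<open>The term \<open>j = 0\<close> has an empty prefix and gives \<open>f (Suc n)\<close>;
  every other term starts with \<open>z\<close>.\<close>

lemma block_sum_0_left: "block_sum z f 0 (Suc n) = f (Suc n) + prepend [z] (block_sum z f 0 n)"
proof -
  have "prepend [] p = p" for p :: "'a list \<Rightarrow>\<^sub>0 int"
    by (simp add: prepend_def frag_expansion[symmetric])
  then show ?thesis
    unfolding block_sum_def by (subst sum.atMost_Suc_shift) (simp add: prepend_sum)
qed

text \<open>Pascal's rule, applied to each coefficient: the two summands tell from which run the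
  first \<open>z\<close> is taken.\<close>

lemma block_sum_Suc_Suc:
  "block_sum z f (Suc m) (Suc n) =
     prepend [z] (block_sum z f m (Suc n)) + prepend [z] (block_sum z f (Suc m) n)"
proof -
  define F where "F j = prepend (replicate (Suc m + j) z) (f (Suc n - j))" for j
  have "block_sum z f (Suc m) (Suc n) = (\<Sum>j\<le>Suc n. frag_cmul (int (Suc m + j choose Suc m)) (F j))"
    by (simp add: block_sum_def F_def)
  also have "\<dots> = (\<Sum>j\<le>Suc n. frag_cmul (int (m + j choose m)) (F j)) +
      (\<Sum>j\<le>Suc n. frag_cmul (int (m + j choose Suc m)) (F j))"
    by (simp only: sum.distrib[symmetric] frag_cmul_distrib[symmetric] add_Suc binomial_Suc_Suc of_nat_add)
  also have "(\<Sum>j\<le>Suc n. frag_cmul (int (m + j choose m)) (F j)) = prepend [z] (block_sum z f m (Suc n))"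
    by (simp add: block_sum_def prepend_sum F_def del: sum.atMost_Suc)
  \<comment> \<open>The term \<open>j = 0\<close> vanishes because \<open>m choose Suc m\<close> is
    0, so the index can be shifted by one.\<close>
  also have "(\<Sum>j\<le>Suc n. frag_cmul (int (m + j choose Suc m)) (F j)) =
      prepend [z] (block_sum z f (Suc m) n)"
    by (subst sum.atMost_Suc_shift) (simp add: block_sum_def prepend_sum F_def)
  finally show ?thesis .
qed

text \<open>Sorts the shuffles by which of \<open>x\<close>, \<open>y\<close> comes first and by the number of letters \<open>z\<close> before it.\<close>

lemma shuffle_words_replicate:
  "shuffle_words (replicate m z @ x # u) (replicate n z @ y # v) =
     block_sum z (\<lambda>i. prepend [x] (shuffle_words u (replicate i z @ y # v))) m n +
     block_sum z (\<lambda>i. prepend [y] (shuffle_words (replicate i z @ x # u) v)) n m"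
proof (induction "m + n" arbitrary: m n)
  case 0
  then show ?case by (simp add: block_sum_def shuffle_words_Cons_Cons)
next
  case (Suc N)
  consider "m = 0" "n = Suc N" | "m = Suc N" "n = 0" |
    m' n' where "m = Suc m'" "n = Suc n'" "N = Suc m' + n'" "N = m' + Suc n'"
    using Suc.hyps(2) by (cases m; cases n) auto
  then show ?case
  proof cases
    \<comment> \<open>Taking \<open>x\<close> first is the term \<open>j = 0\<close> of the first
      block sum; taking \<open>z\<close> first is covered by the induction hypothesis. The next case
      is its mirror image.\<close>
    case 1
    with Suc.hyps(1)[of 0 N] show ?thesis
      by (simp add: shuffle_words_Cons_Cons block_sum_0_left block_sum_0_right)
  next
    case 2
    with Suc.hyps(1)[of N 0] show ?thesis
      by (simp add: shuffle_words_Cons_Cons block_sum_0_left block_sum_0_right)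
  next
    case 3
    with Suc.hyps(1)[of m' "Suc n'"] Suc.hyps(1)[of "Suc m'" n'] show ?thesis
      by (simp add: shuffle_words_Cons_Cons block_sum_Suc_Suc)
  qed
qed

subsection \<open>Block expansions\<close>

text \<open>In a pattern, \<open>True\<close> marks the positions taken by the first of the two words.\<close>

definition patterns :: "nat \<Rightarrow> nat \<Rightarrow> bool list set" where
  "patterns k l = {e. count_list e True = k \<and> count_list e False = l}"

text \<open>For a pattern in \<open>patterns (length xs) (length ys)\<close> the last clause is
  reached exactly when the pattern and both lists are empty.\<close>

fun interleave :: "bool list \<Rightarrow> 'x list \<Rightarrow> 'x list \<Rightarrow> 'x list" where
  "interleave (True # e) (x # xs) ys = x # interleave e xs ys"
| "interleave (False # e) xs (y # ys) = y # interleave e xs ys"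
| "interleave e xs ys = []"

text \<open>List counterpart of \<open>weight_set\<close>, which allows recursion on the first block
  length.\<close>

definition compositions :: "nat \<Rightarrow> nat \<Rightarrow> nat list set" where
  "compositions n m = {ts. length ts = n \<and> set ts \<subseteq> {1..} \<and> sum_list ts = m}"

text \<open>Charges \<open>x\<close> letters to the first block that the other word has left. On an
  empty list the charge is lost; the bound on the total length in \<open>pcoeff_Nil_right\<close>
  makes up for this.\<close>

fun lower :: "int \<Rightarrow> int list \<Rightarrow> int list" where
  "lower x [] = []"
| "lower x (s # ss) = (s - x) # ss"

text \<open>
  The lists hold the lengths that the blocks still have. They are integers: a block that has been
  overdrawn (length at most 0) makes a later binomial coefficient vanish.
\<close>

fun pcoeff :: "int list \<Rightarrow> int list \<Rightarrow> bool list \<Rightarrow> nat list \<Rightarrow> int" where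
  "pcoeff (r # rs) ss (True # e) (t # ts) =
     binom (int t - 1) (r - 1) * pcoeff rs (lower (int t - r) ss) e ts"
| "pcoeff rs (s # ss) (False # e) (t # ts) =
     binom (int t - 1) (s - 1) * pcoeff (lower (int t - s) rs) ss e ts"
| "pcoeff [] [] [] [] = 1"
| "pcoeff _ _ _ _ = 0"

lemma length_pattern: "e \<in> patterns k l \<Longrightarrow> length e = k + l"
  by (induction e arbitrary: k l) (force simp: patterns_def split: if_splits)+

lemma finite_patterns: "finite (patterns k l)"
  by (rule finite_subset[OF _ finite_lists_length_eq[of UNIV "k + l"]]) (auto simp: length_pattern)

lemma patterns_Suc_Suc:
  "patterns (Suc k) (Suc l) = (#) True ` patterns k (Suc l) \<union> (#) False ` patterns (Suc k) l"
proof -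
  have "e \<in> patterns (Suc k) (Suc l) \<longleftrightarrow>
    e \<in> (#) True ` patterns k (Suc l) \<union> (#) False ` patterns (Suc k) l" for e
    by (cases e) (auto simp: patterns_def)
  then show ?thesis by blast
qed

lemma sum_patterns_Suc_Suc:
  "(\<Sum>e\<in>patterns (Suc k) (Suc l). f e) =
     (\<Sum>e\<in>patterns k (Suc l). f (True # e)) + (\<Sum>e\<in>patterns (Suc k) l. f (False # e))"
  unfolding patterns_Suc_Suc
  by (subst sum.union_disjoint) (auto simp: finite_patterns sum.reindex)

lemma finite_compositions: "finite (compositions n m)"
proof (rule finite_subset[OF _ finite_lists_length_eq[of "{..m}" n]])
  show "compositions n m \<subseteq> {xs. set xs \<subseteq> {..m} \<and> length xs = n}"
    by (auto simp: compositions_def dest: member_le_sum_list)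
qed auto

lemma sum_compositions_Suc:
  "(\<Sum>ts\<in>compositions (Suc n) m. f ts) = (\<Sum>t=1..m. \<Sum>ts\<in>compositions n (m - t). f (t # ts))"
proof -
  have "(\<Sum>ts\<in>compositions (Suc n) m. f ts) =
      (\<Sum>(t, ts)\<in>Sigma {1..m} (\<lambda>t. compositions n (m - t)). f (t # ts))"
    by (rule sum.reindex_bij_witness[of _ "\<lambda>(t, ts). t # ts" "\<lambda>ts. (hd ts, tl ts)"])
      (auto simp: compositions_def length_Suc_conv)
  then show ?thesis by (simp add: sum.Sigma finite_compositions)
qed

text \<open>The claimed formula in terms of lists, before \<open>rho\<close> is applied. The weight
  \<open>m\<close> is a separate argument so that overdrawn blocks are allowed in the
  recursion.\<close>

definition block_expansion ::
    "int list \<Rightarrow> 'g list \<Rightarrow> int list \<Rightarrow> 'g list \<Rightarrow> nat \<Rightarrow> ('g option list \<Rightarrow>\<^sub>0 int)" where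
  "block_expansion rs as ss bs m =
     (\<Sum>e\<in>patterns (length rs) (length ss). \<Sum>ts\<in>compositions (length rs + length ss) m.
        frag_cmul (pcoeff rs ss e ts) (frag_of (xword (zip ts (interleave e as bs)))))"

text \<open>Splits off the first entry of the pattern and the first block length, which gives the
  shape of \<open>shuffle_words_replicate\<close>.\<close>

lemma block_expansion_Cons_Cons:
  "block_expansion (r # rs) (a # as) (s # ss) (b # bs) m =
     (\<Sum>t=1..m. frag_cmul (binom (int t - 1) (r - 1))
        (prepend (replicate (t - 1) None @ [Some a])
          (block_expansion rs as ((s - (int t - r)) # ss) (b # bs) (m - t)))) +
     (\<Sum>t=1..m. frag_cmul (binom (int t - 1) (s - 1))
        (prepend (replicate (t - 1) None @ [Some b])
          (block_expansion ((r - (int t - s)) # rs) (a # as) ss bs (m - t))))"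
proof -
  \<comment> \<open>With patterns outside and lengths inside, the types keep this exchange of sums
    from looping as a rewrite rule.\<close>
  have swap: "(\<Sum>e\<in>E. \<Sum>t=Suc 0..m. f e t) = (\<Sum>t=Suc 0..m. \<Sum>e\<in>E. f e t)"
    for E :: "bool list set" and f :: "bool list \<Rightarrow> nat \<Rightarrow> 'a option list \<Rightarrow>\<^sub>0 int"
    by (rule sum.swap)
  show ?thesis
    unfolding block_expansion_def
    by (simp add: sum_patterns_Suc_Suc sum_compositions_Suc prepend_sum finite_patterns
        finite_compositions frag_cmul_sum swap sum.distrib)
qed

lemma pcoeff_nonpos_right:
  "s \<le> 0 \<Longrightarrow> pcoeff rs (s # ss) e ts = 0"
proof (induction e arbitrary: rs s ts)
  case Nil
  then show ?case by (cases rs; cases ts) auto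
next
  case (Cons p e)
  show ?case
  proof (cases ts)
    case Nil
    then show ?thesis by (cases rs; cases p) auto
  next
    case ts: (Cons t ts')
    show ?thesis
    proof (cases p)
      case True
      show ?thesis
      proof (cases rs)
        case (Cons r rs')
        then show ?thesis
          using Cons.IH[of "s - (int t - r)" rs' ts'] Cons.prems ts True
          \<comment> \<open>Either \<open>r\<close> is at most \<open>t\<close> and \<open>s\<close>
            only decreases further, or the factor of the current block is already 0.\<close>
          by (cases "r \<le> int t") (auto simp: binom_def)
      qed (use True ts in auto)
    next
      case False
      then show ?thesis using Cons.prems ts by (auto simp: binom_def)
    qed
  qed
qed

lemma lower_lower: "lower x (lower y ss) = lower (y + x) ss"
  by (cases ss) auto

lemma lower_0 [simp]: "lower 0 ss = ss"
  by (cases ss) auto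

lemma pcoeff_swap: "pcoeff rs ss e ts = pcoeff ss rs (map Not e) ts"
  by (induction rs ss e ts rule: pcoeff.induct) auto

lemma pcoeff_nonpos_left: "r \<le> 0 \<Longrightarrow> pcoeff (r # rs) ss e ts = 0"
  by (subst pcoeff_swap) (rule pcoeff_nonpos_right)

lemma interleave_swap: "interleave e xs ys = interleave (map Not e) ys xs"
  by (induction e xs ys rule: interleave.induct) auto

text \<open>Substitutes \<open>t = r + j\<close>, to match block sums with
  \<open>block_expansion_Cons_Cons\<close>. Lengths \<open>t < r\<close> add nothing because of the
  binomial coefficient, lengths from \<open>r + s\<close> on because of \<open>h\<close>.\<close>

lemma block_sum_eq_sum_length:
  assumes "r \<ge> 1" "s \<ge> 1" "r + s \<le> Suc m"
    and f: "\<And>j. j < s \<Longrightarrow> f (s - 1 - j) = prepend [x] (h (r + j))"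
    and h: "\<And>t. r + s \<le> t \<Longrightarrow> t \<le> m \<Longrightarrow> h t = 0"
  shows "block_sum z f (r - 1) (s - 1) =
    (\<Sum>t=1..m. frag_cmul (binom (int t - 1) (int r - 1)) (prepend (replicate (t - 1) z @ [x]) (h t)))"
proof -
  define F where "F t = frag_cmul (binom (int t - 1) (int r - 1)) (prepend (replicate (t - 1) z @ [x]) (h t))" for t
  have "(\<Sum>t=1..m. F t) = (\<Sum>t\<in>{r..<r + s}. F t)"
  proof (rule sum.mono_neutral_right)
    show "\<forall>t\<in>{1..m} - {r..<r + s}. F t = 0"
      using h assms(1) by (auto simp: F_def binom_def not_le)
  qed (use assms in auto)
  also have "\<dots> = (\<Sum>j<s. F (r + j))"
    by (rule sum.reindex_bij_witness[of _ "\<lambda>j. r + j" "\<lambda>t. t - r"]) auto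
  also have "\<dots> = (\<Sum>j<s. frag_cmul (int (r - 1 + j choose (r - 1)))
      (prepend (replicate (r - 1 + j) z) (f (s - 1 - j))))"
  proof (rule sum.cong)
    fix j assume "j \<in> {..<s}"
    have "int (r + j) - 1 = int (r - 1 + j)" "int r - 1 = int (r - 1)" "r + j - 1 = r - 1 + j"
      using assms(1) by auto
    then show "F (r + j) = frag_cmul (int (r - 1 + j choose (r - 1)))
      (prepend (replicate (r - 1 + j) z) (f (s - 1 - j)))"
      using f[of j] \<open>j \<in> {..<s}\<close> by (simp only: F_def binom_of_nat prepend_prepend lessThan_iff)
  qed simp
  also have "\<dots> = block_sum z f (r - 1) (s - 1)"
    using assms(2) by (auto simp: block_sum_def intro!: sum.cong)
  finally show ?thesis by (simp add: F_def)
qed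

text \<open>A nonzero product forces each part of \<open>ts\<close> to be at least the matching part
  of \<open>ns\<close>, so the bound on the sums forces equality. An inequality between the sums,
  unlike an equation, passes to the tails.\<close>

lemma pcoeff_Nil_right:
  assumes "length ts = length ns" "sum_list ts \<le> sum_list ns" "set ts \<subseteq> {1..}"
  shows "pcoeff (map int ns) [] (replicate (length ns) True) ts = (if ts = ns then 1 else 0)"
  using assms
proof (induction ns arbitrary: ts)
  case (Cons n ns)
  then obtain t ts' where ts: "ts = t # ts'" by (cases ts) auto
  show ?case
  proof (cases "n \<le> t")
    case True
    then have "pcoeff (map int ns) [] (replicate (length ns) True) ts' = (if ts' = ns then 1 else 0)"
      using Cons.prems ts by (intro Cons.IH) auto
    then show ?thesis using Cons.prems True ts by (auto simp: binom_def)
  qed (use ts Cons.prems in \<open>auto simp: binom_def\<close>)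
qed simp

lemma patterns_0_right: "patterns k 0 = {replicate k True}"
proof -
  have "e \<in> patterns k 0 \<longleftrightarrow> e = replicate k True" for e
  proof (induction e arbitrary: k)
    case (Cons p e)
    then show ?case by (cases k) (auto simp: patterns_def)
  qed (auto simp: patterns_def)
  then show ?thesis by blast
qed

lemma patterns_swap: "patterns l k = map Not ` patterns k l"
proof -
  have c: "count_list (map Not e) p = count_list e (\<not> p)" for e p
    by (induction e) auto
  show ?thesis
  proof
    show "map Not ` patterns k l \<subseteq> patterns l k" by (auto simp: patterns_def c)
    show "patterns l k \<subseteq> map Not ` patterns k l"
    proof
      fix e assume "e \<in> patterns l k"
      then have "map Not e \<in> patterns k l" by (auto simp: patterns_def c)
      moreover have "e = map Not (map Not e)" by (simp add: o_def)
      ultimately show "e \<in> map Not ` patterns k l" by (rule rev_image_eqI)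
    qed
  qed
qed

text \<open>Negating the pattern exchanges the roles of the two words; this reduces an empty first
  word to an empty second one.\<close>

lemma block_expansion_swap: "block_expansion rs as ss bs m = block_expansion ss bs rs as m"
proof -
  have "inj_on (map Not) E" for E :: "bool list set"
    by (rule inj_on_subset[of _ UNIV]) (auto intro: inj_mapI simp: inj_def)
  then show ?thesis
    unfolding block_expansion_def patterns_swap[of "length rs" "length ss"]
    by (simp add: sum.reindex pcoeff_swap[of ss rs] interleave_swap[of _ bs as] add.commute)
qed

lemma interleave_replicate_True: "interleave (replicate (length xs) True) xs [] = xs"
  by (induction xs) auto

text \<open>Only the constant pattern exists, and only the original block lengths have a nonzero
  coefficient.\<close>

lemma block_expansion_Nil_right:
  assumes "set us \<subseteq> {1..} \<times> UNIV"
  shows "block_expansion (map (int \<circ> fst) us) (map snd us) [] [] (sum_list (map fst us)) =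
    frag_of (xword us)"
proof -
  let ?ns = "map fst us" and ?cs = "map snd us"
  have mem: "?ns \<in> compositions (length us) (sum_list ?ns)"
    using assms by (auto simp: compositions_def)
  have zip: "zip ?ns ?cs = us" by (rule zip_map_fst_snd)
  have "block_expansion (map int ?ns) ?cs [] [] (sum_list ?ns) =
    (\<Sum>ts\<in>compositions (length us) (sum_list ?ns).
        if ts = ?ns then frag_of (xword (zip ts ?cs)) else 0)"
    unfolding block_expansion_def
    using interleave_replicate_True[of ?cs] pcoeff_Nil_right[of _ ?ns]
    by (simp add: patterns_0_right) (rule sum.cong, auto simp: compositions_def)
  also have "\<dots> = frag_of (xword us)"
    using mem zip by (simp add: sum.delta finite_compositions cong: if_cong)
  finally show ?thesis by simp
qed

lemma block_expansion_nonpos: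
  assumes "r \<le> 0"
  shows "block_expansion (r # rs) as ss bs m = 0" "block_expansion ss bs (r # rs) as m = 0"
  using assms by (simp_all add: block_expansion_def pcoeff_nonpos_left pcoeff_nonpos_right)

text \<open>Induction on the number of blocks, with arbitrary lengths: each step removes one block
  entirely and merely shortens the first block of the other word.\<close>

proposition shuffle_words_xword:
  assumes "set us \<subseteq> {1..} \<times> UNIV" "set vs \<subseteq> {1..} \<times> UNIV"
  shows "shuffle_words (xword us) (xword vs) =
    block_expansion (map (int \<circ> fst) us) (map snd us) (map (int \<circ> fst) vs) (map snd vs)
      (sum_list (map fst us) + sum_list (map fst vs))"
  using assms
proof (induction "length us + length vs" arbitrary: us vs rule: less_induct)
  case less
  consider "vs = []" | "us = []" |
    r a us' s b vs' where "us = (r, a) # us'" "vs = (s, b) # vs'"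
    by (metis list.exhaust surj_pair)
  then show ?case
  proof cases
    case 1
    then show ?thesis
      using block_expansion_Nil_right[OF less.prems(1)] by simp
  next
    case 2
    then show ?thesis
      using block_expansion_Nil_right[OF less.prems(2)]
      by (simp add: block_expansion_swap[of "[]" "[]" "map (int \<circ> fst) vs"])
  next
    case (3 r a us' s b vs')
    note us = 3(1) and vs = 3(2)
    have pos: "r \<ge> 1" "s \<ge> 1" "set us' \<subseteq> {1..} \<times> UNIV" "set vs' \<subseteq> {1..} \<times> UNIV"
      using less.prems us vs by auto
    let ?R = "map (int \<circ> fst) us'" and ?A = "map snd us'"
    let ?S = "map (int \<circ> fst) vs'" and ?B = "map snd vs'"
    define m where "m = sum_list (map fst us) + sum_list (map fst vs)"
    have m: "m = r + s + sum_list (map fst us') + sum_list (map fst vs')"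
      by (simp add: m_def us vs)
    have left: "block_sum None (\<lambda>i. prepend [Some a] (shuffle_words (xword us')
          (replicate i None @ Some b # xword vs'))) (r - 1) (s - 1) =
      (\<Sum>t=1..m. frag_cmul (binom (int t - 1) (int r - 1))
        (prepend (replicate (t - 1) None @ [Some a])
          (block_expansion ?R ?A ((int s - (int t - int r)) # ?S) (b # ?B) (m - t))))"
    proof (rule block_sum_eq_sum_length)
      fix j assume "j < s"
      have "shuffle_words (xword us') (xword ((s - j, b) # vs')) =
        block_expansion ?R ?A (int (s - j) # ?S) (b # ?B)
          (sum_list (map fst us') + (s - j + sum_list (map fst vs')))"
        using less.hyps[of us' "(s - j, b) # vs'"] pos \<open>j < s\<close> by (auto simp: us vs)
      \<comment> \<open>Here \<open>t = r + j\<close>. Since \<open>j < s\<close>, the shortened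
        block has positive length, and the natural number \<open>s - j\<close> agrees with the
        integer length in the expansion.\<close>
      moreover have "int (s - j) = int s - (int (r + j) - int r)"
        "sum_list (map fst us') + (s - j + sum_list (map fst vs')) = m - (r + j)"
        using \<open>j < s\<close> by (auto simp: m)
      ultimately show "prepend [Some a] (shuffle_words (xword us')
            (replicate (s - 1 - j) None @ Some b # xword vs')) =
          prepend [Some a] (block_expansion ?R ?A ((int s - (int (r + j) - int r)) # ?S) (b # ?B) (m - (r + j)))"
        by (simp add: diff_commute)
    \<comment> \<open>For \<open>t\<close> at least \<open>r + s\<close> the block of the second
      word is used up or overdrawn, so the expansion is 0.\<close>
    qed (use pos in \<open>auto simp: m block_expansion_nonpos\<close>)
    have right: "block_sum None (\<lambda>i. prepend [Some b] (shuffle_words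
          (replicate i None @ Some a # xword us') (xword vs'))) (s - 1) (r - 1) =
      (\<Sum>t=1..m. frag_cmul (binom (int t - 1) (int s - 1))
        (prepend (replicate (t - 1) None @ [Some b])
          (block_expansion ((int r - (int t - int s)) # ?R) (a # ?A) ?S ?B (m - t))))"
    proof (rule block_sum_eq_sum_length)
      fix j assume "j < r"
      have "shuffle_words (xword ((r - j, a) # us')) (xword vs') =
        block_expansion (int (r - j) # ?R) (a # ?A) ?S ?B
          (r - j + sum_list (map fst us') + sum_list (map fst vs'))"
        using less.hyps[of "(r - j, a) # us'" vs'] pos \<open>j < r\<close> by (auto simp: us vs)
      moreover have "int (r - j) = int r - (int (s + j) - int s)"
        "r - j + sum_list (map fst us') + sum_list (map fst vs') = m - (s + j)"
        using \<open>j < r\<close> by (auto simp: m)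
      ultimately show "prepend [Some b] (shuffle_words
            (replicate (r - 1 - j) None @ Some a # xword us') (xword vs')) =
          prepend [Some b] (block_expansion ((int r - (int (s + j) - int s)) # ?R) (a # ?A) ?S ?B (m - (s + j)))"
        by (simp add: diff_commute)
    qed (use pos in \<open>auto simp: m block_expansion_nonpos\<close>)
    have "shuffle_words (xword us) (xword vs) =
        block_expansion (int r # ?R) (a # ?A) (int s # ?S) (b # ?B) m"
      unfolding block_expansion_Cons_Cons left[symmetric] right[symmetric]
      by (simp only: us vs xword_Cons shuffle_words_replicate)
    then show ?thesis by (simp only: m_def us vs list.map o_apply fst_conv snd_conv)
  qed
qed

subsection \<open>Closed form of the coefficients\<close>

text \<open>
  \<open>q\<close> tells which word the preceding letter came from, and \<open>x\<close> is the number of letters already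
  taken from the current block of the other word.
\<close>

fun run_coeff :: "bool \<Rightarrow> int \<Rightarrow> (bool \<times> int \<times> nat) list \<Rightarrow> int" where
  "run_coeff q x [] = 1"
| "run_coeff q x ((p, h, t) # zs) =
     (if p = q then binom (int t - 1) (h - 1) else binom (int t - 1) (x + int t - h)) *
     run_coeff p (x + int t - h) zs"

text \<open>Both statements go through one induction because the lowered word changes with the side
  of the last letter. Whether or not the side changes, \<open>x\<close> becomes
  \<open>x + int t - h\<close>: on a change, the surplus over the remaining \<open>h - x\<close> is
  charged to an untouched block.\<close>

lemma pcoeff_eq_run_coeff:
  assumes "e \<in> patterns (length rs) (length ss)" "length ts = length e" "set ts \<subseteq> {1..}"
  shows "pcoeff rs (lower x ss) e ts = run_coeff True x (zip e (zip (interleave e rs ss) ts))"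
    "pcoeff (lower x rs) ss e ts = run_coeff False x (zip e (zip (interleave e rs ss) ts))"
  using assms
proof (induction e arbitrary: rs ss ts x)
  case Nil
  {
    case 1 then show ?case by (auto simp: patterns_def)
  next
    case 2 then show ?case by (auto simp: patterns_def)
  }
next
  case (Cons p e)
  \<comment> \<open>Symmetry turns the remaining length \<open>h - x\<close> into the lower entry
    used by \<open>run_coeff\<close>; \<open>t\<close> at least 1 keeps the upper entry
    nonnegative.\<close>
  have sym: "binom (int t - 1) (h - x - 1) = binom (int t - 1) (x + int t - h)" if "t \<ge> 1" for t h x
    using that binom_symmetric[of "int t - 1" "h - x - 1"] by (simp add: algebra_simps)
  {
    case 1
    then obtain t ts' where ts: "ts = t # ts'" "t \<ge> 1" "length ts' = length e" "set ts' \<subseteq> {1..}"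
      by (cases ts) auto
    show ?case
    proof (cases p)
      case True
      with 1 obtain r rs' where rs: "rs = r # rs'" by (cases rs) (auto simp: patterns_def)
      have "e \<in> patterns (length rs') (length ss)" using 1 True rs by (auto simp: patterns_def)
      then show ?thesis
        using Cons.IH(1)[of rs' ss ts' "x + int t - r"] ts True rs
        by (simp add: lower_lower algebra_simps)
    next
      case False
      with 1 obtain s ss' where ss: "ss = s # ss'" by (cases ss) (auto simp: patterns_def)
      have "e \<in> patterns (length rs) (length ss')" using 1 False ss by (auto simp: patterns_def)
      then show ?thesis
        using Cons.IH(2)[of rs ss' ts' "x + int t - s"] ts False ss sym[of t s x]
        by (simp add: algebra_simps)
    qed
  next
    case 2
    then obtain t ts' where ts: "ts = t # ts'" "t \<ge> 1" "length ts' = length e" "set ts' \<subseteq> {1..}"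
      by (cases ts) auto
    show ?case
    proof (cases p)
      case True
      with 2 obtain r rs' where rs: "rs = r # rs'" by (cases rs) (auto simp: patterns_def)
      have "e \<in> patterns (length rs') (length ss)" using 2 True rs by (auto simp: patterns_def)
      then show ?thesis
        using Cons.IH(1)[of rs' ss ts' "x + int t - r"] ts True rs sym[of t r x]
        by (simp add: algebra_simps)
    next
      case False
      with 2 obtain s ss' where ss: "ss = s # ss'" by (cases ss) (auto simp: patterns_def)
      have "e \<in> patterns (length rs) (length ss')" using 2 False ss by (auto simp: patterns_def)
      then show ?thesis
        using Cons.IH(2)[of rs ss' ts' "x + int t - s"] ts False ss
        by (simp add: lower_lower algebra_simps)
    qed
  }
qed

text \<open>The updates of \<open>x\<close> add up to differences of partial sums. At the first
  index \<open>j\<close>, \<open>q\<close> stands in for the side of the preceding letter.\<close>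

lemma run_coeff_map_upt:
  "run_coeff q x (map (\<lambda>i. (p i, h i, t i)) [j..<Suc n]) =
    (\<Prod>i=j..n. if p i = (if i = j then q else p (i - 1)) then binom (int (t i) - 1) (h i - 1)
       else binom (int (t i) - 1) (x + (\<Sum>m=j..i. int (t m)) - (\<Sum>m=j..i. h m)))"
proof (induction "Suc n - j" arbitrary: j q x)
  case 0
  then show ?case by simp
next
  case (Suc d)
  then have "j \<le> n" by simp
  have "run_coeff q x (map (\<lambda>i. (p i, h i, t i)) [j..<Suc n]) =
    (if p j = q then binom (int (t j) - 1) (h j - 1) else binom (int (t j) - 1) (x + int (t j) - h j)) *
     run_coeff (p j) (x + int (t j) - h j) (map (\<lambda>i. (p i, h i, t i)) [Suc j..<Suc n])"
    using \<open>j \<le> n\<close> by (simp add: upt_rec[of j "Suc n"] del: upt_Suc)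
  also have "run_coeff (p j) (x + int (t j) - h j) (map (\<lambda>i. (p i, h i, t i)) [Suc j..<Suc n]) =
    (\<Prod>i=Suc j..n. if p i = (if i = Suc j then p j else p (i - 1)) then binom (int (t i) - 1) (h i - 1)
       else binom (int (t i) - 1) (x + int (t j) - h j + (\<Sum>m=Suc j..i. int (t m)) - (\<Sum>m=Suc j..i. h m)))"
    using Suc by (intro Suc.hyps(1)) auto
  also have "\<dots> = (\<Prod>i=Suc j..n. if p i = (if i = j then q else p (i - 1)) then binom (int (t i) - 1) (h i - 1)
       else binom (int (t i) - 1) (x + (\<Sum>m=j..i. int (t m)) - (\<Sum>m=j..i. h m)))"
    by (rule prod.cong) (auto simp: sum.atLeast_Suc_atMost[of j] algebra_simps)
  finally show ?case
    using \<open>j \<le> n\<close> by (simp add: prod.atLeast_Suc_atMost)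
qed

section \<open>Length and entries of an interleaving\<close>

lemma count_lists_0: "count_list e True = 0 \<Longrightarrow> count_list e False = 0 \<Longrightarrow> e = []"
  by (cases e) (auto split: if_splits)

lemma length_interleave:
  "e \<in> patterns (length xs) (length ys) \<Longrightarrow> length (interleave e xs ys) = length e"
  by (induction e xs ys rule: interleave.induct) (auto simp: patterns_def dest: count_lists_0)

lemma nth_interleave:
  assumes "e \<in> patterns (length xs) (length ys)" "i < length e"
  shows "interleave e xs ys ! i =
    (if e ! i then xs ! count_list (take i e) True else ys ! count_list (take i e) False)"
  using assms
proof (induction e xs ys arbitrary: i rule: interleave.induct)
  case (1 e x xs ys)
  then show ?case by (cases i) (auto simp: patterns_def)
next
  case (2 e xs y ys)
  then show ?case by (cases i) (auto simp: patterns_def)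
qed (auto simp: patterns_def dest: count_lists_0)

lemma set_interleave: "set (interleave e xs ys) \<subseteq> set xs \<union> set ys"
  by (induction e xs ys rule: interleave.induct) auto

subsection \<open>Patterns as pairs of order-preserving maps\<close>

text \<open>The values below \<open>\<phi> j\<close> are those at the indices below
  \<open>j\<close>. Thus the inverse of an increasing map is the rank in its image.\<close>

lemma strict_mono_on_inv_card:
  fixes \<phi> :: "nat \<Rightarrow> nat"
  assumes "strict_mono_on {1..k} \<phi>" "\<phi> \<in> {1..k} \<rightarrow> {1..n}" "j \<in> {1..k}"
  shows "card (\<phi> ` {1..k} \<inter> {1..<\<phi> j}) = j - 1"
proof -
  have iff: "\<phi> i < \<phi> j \<longleftrightarrow> i < j" if "i \<in> {1..k}" for i
    using strict_mono_on_less[OF assms(1)] that assms(3) by auto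
  have inj: "inj_on \<phi> {1..k}" using assms(1) by (rule strict_mono_on_imp_inj_on)
  have "\<phi> ` {1..k} \<inter> {1..<\<phi> j} = \<phi> ` {1..<j}"
    using assms(2,3) iff by (force simp: image_iff)
  moreover have "inj_on \<phi> {1..<j}"
    by (rule inj_on_subset[OF inj]) (use assms(3) in auto)
  ultimately show ?thesis by (simp add: card_image)
qed

lemma I_setD:
  assumes "(\<phi>, \<psi>) \<in> I_set k l"
  shows "strict_mono_on {1..k} \<phi>" "strict_mono_on {1..l} \<psi>"
    "\<phi> \<in> {1..k} \<rightarrow>\<^sub>E {1..k + l}" "\<psi> \<in> {1..l} \<rightarrow>\<^sub>E {1..k + l}"
    "\<psi> ` {1..l} = {1..k + l} - \<phi> ` {1..k}"
proof -
  note I = assms[unfolded I_set_def, simplified mem_Collect_eq case_prod_conv]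
  have strict: "strict_mono_on A f" if "mono_on A f" "inj_on f A" for A and f :: "nat \<Rightarrow> nat"
  proof (rule strict_mono_onI)
    fix x y assume "x \<in> A" "y \<in> A" "x < y"
    then have "f x \<le> f y" "f x \<noteq> f y"
      using mono_onD[OF that(1), of x y] inj_onD[OF that(2), of x y] by auto
    then show "f x < f y" by simp
  qed
  show "strict_mono_on {1..k} \<phi>" "strict_mono_on {1..l} \<psi>"
    "\<phi> \<in> {1..k} \<rightarrow>\<^sub>E {1..k + l}" "\<psi> \<in> {1..l} \<rightarrow>\<^sub>E {1..k + l}"
    using I by (simp_all add: strict)
  have "\<phi> ` {1..k} \<inter> \<psi> ` {1..l} = {}" "\<phi> ` {1..k} \<union> \<psi> ` {1..l} = {1..k + l}"
    using I by (simp_all only:)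
  then show "\<psi> ` {1..l} = {1..k + l} - \<phi> ` {1..k}" by blast
qed

text \<open>Characteristic list of \<open>A\<close>, the image of the first map. This image
  determines the pair, since the second image is its complement and increasing enumerations are
  unique.\<close>

definition pattern_of :: "nat \<Rightarrow> nat \<Rightarrow> nat set \<Rightarrow> bool list" where
  "pattern_of k l A = map (\<lambda>i. i \<in> A) [1..<Suc (k + l)]"

lemma count_list_map_upt:
  "count_list (map f [1..<Suc n]) y = card {i \<in> {1..n}. f i = y}"
proof (induction n)
  case (Suc n)
  have "{i \<in> {1..Suc n}. f i = y} = {i \<in> {1..n}. f i = y} \<union> (if f (Suc n) = y then {Suc n} else {})"
    by (auto simp: le_Suc_eq)
  then show ?case using Suc by simp
qed simp

lemma count_list_take_pattern_of:
  assumes "i < k + l"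
  shows "count_list (take i (pattern_of k l A)) True = card (A \<inter> {1..<Suc i})"
    "count_list (take i (pattern_of k l A)) False = card (({1..k + l} - A) \<inter> {1..<Suc i})"
proof -
  have "take i (pattern_of k l A) = map (\<lambda>i. i \<in> A) [1..<Suc i]"
    using assms by (simp add: pattern_of_def take_map take_upt del: upt_Suc)
  moreover have "{j \<in> {1..i}. (j \<in> A) = True} = A \<inter> {1..<Suc i}"
    "{j \<in> {1..i}. (j \<in> A) = False} = ({1..k + l} - A) \<inter> {1..<Suc i}"
    using assms by auto
  ultimately show "count_list (take i (pattern_of k l A)) True = card (A \<inter> {1..<Suc i})"
    "count_list (take i (pattern_of k l A)) False = card (({1..k + l} - A) \<inter> {1..<Suc i})"
    by (simp_all only: count_list_map_upt)
qed

lemma pattern_of_in_patterns: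
  assumes "A \<subseteq> {1..k + l}" "card A = k"
  shows "pattern_of k l A \<in> patterns k l"
proof -
  have "{i \<in> {1..k + l}. (i \<in> A) = True} = A" "{i \<in> {1..k + l}. (i \<in> A) = False} = {1..k + l} - A"
    using assms by auto
  then show ?thesis
    using assms by (simp add: patterns_def pattern_of_def count_list_map_upt card_Diff_subset
        finite_subset[of A "{1..k + l}"] del: upt_Suc One_nat_def)
qed

lemma pattern_of_I_set:
  assumes "(\<phi>, \<psi>) \<in> I_set k l"
  shows "pattern_of k l (\<phi> ` {1..k}) \<in> patterns k l"
proof (rule pattern_of_in_patterns)
  show "\<phi> ` {1..k} \<subseteq> {1..k + l}" using I_setD(3)[OF assms] by auto
  show "card (\<phi> ` {1..k}) = k"
    using strict_mono_on_imp_inj_on[OF I_setD(1)[OF assms]] by (simp add: card_image)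
qed

text \<open>Both sides select an entry by the rank of its position: \<open>interleave\<close> counts
  earlier entries of the same kind, \<open>merge_vec\<close> inverts an increasing map.\<close>

lemma interleave_pattern_of:
  assumes "(\<phi>, \<psi>) \<in> I_set k l"
  shows "interleave (pattern_of k l (\<phi> ` {1..k})) (map a [1..<Suc k]) (map b [1..<Suc l]) =
    map (merge_vec k l (\<phi>, \<psi>) a b) [1..<Suc (k + l)]"
    (is "interleave ?e ?a ?b = _")
proof (rule nth_equalityI)
  note I = I_setD[OF assms]
  have e: "?e \<in> patterns (length ?a) (length ?b)"
    using pattern_of_I_set[OF assms] by (simp del: upt_Suc)
  then show "length (interleave ?e ?a ?b) = length (map (merge_vec k l (\<phi>, \<psi>) a b) [1..<Suc (k + l)])"
    by (simp add: length_interleave pattern_of_def del: upt_Suc)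
  fix i assume "i < length (interleave ?e ?a ?b)"
  with e have i: "i < k + l" by (simp add: length_interleave pattern_of_def del: upt_Suc)
  \<comment> \<open>The list index \<open>i\<close> is position \<open>Suc i\<close>, so the entries
    before it sit at \<open>{1..<Suc i}\<close>.\<close>
  have nth: "interleave ?e ?a ?b ! i =
    (if Suc i \<in> \<phi> ` {1..k} then ?a ! card (\<phi> ` {1..k} \<inter> {1..<Suc i})
     else ?b ! card (\<psi> ` {1..l} \<inter> {1..<Suc i}))"
    using nth_interleave[OF e, of i] i count_list_take_pattern_of[OF i, of "\<phi> ` {1..k}"] I(5)
    by (simp add: pattern_of_def del: upt_Suc)
  show "interleave ?e ?a ?b ! i = map (merge_vec k l (\<phi>, \<psi>) a b) [1..<Suc (k + l)] ! i"
  proof (cases "Suc i \<in> \<phi> ` {1..k}")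
    case True
    then obtain j where j: "j \<in> {1..k}" "Suc i = \<phi> j" by auto
    have "card (\<phi> ` {1..k} \<inter> {1..<\<phi> j}) = j - 1"
      using strict_mono_on_inv_card[OF I(1) _ j(1)] I(3) by (auto simp: PiE_def)
    moreover have "the_inv_into {1..k} \<phi> (\<phi> j) = j"
      using the_inv_into_f_f[OF strict_mono_on_imp_inj_on[OF I(1)] j(1)] .
    ultimately show ?thesis
      using True i j nth by (auto simp: merge_vec_def simp del: upt_Suc)
  next
    case False
    then have "Suc i \<in> \<psi> ` {1..l}" using I(5) i by auto
    then obtain j where j: "j \<in> {1..l}" "Suc i = \<psi> j" by auto
    have "card (\<psi> ` {1..l} \<inter> {1..<\<psi> j}) = j - 1"
      using strict_mono_on_inv_card[OF I(2) _ j(1)] I(4) by (auto simp: PiE_def)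
    moreover have "the_inv_into {1..l} \<psi> (\<psi> j) = j"
      using the_inv_into_f_f[OF strict_mono_on_imp_inj_on[OF I(2)] j(1)] .
    ultimately show ?thesis
      using False i j nth by (auto simp: merge_vec_def simp del: upt_Suc)
  qed
qed

lemma strict_mono_on_eqI:
  fixes \<phi> \<phi>' :: "nat \<Rightarrow> nat"
  assumes "strict_mono_on {1..k} \<phi>" "strict_mono_on {1..k} \<phi>'"
    "\<phi> \<in> {1..k} \<rightarrow>\<^sub>E {1..n}" "\<phi>' \<in> {1..k} \<rightarrow>\<^sub>E {1..n}" "\<phi> ` {1..k} = \<phi>' ` {1..k}"
  shows "\<phi> = \<phi>'"
proof (rule PiE_ext[OF assms(3,4)])
  fix j assume j: "j \<in> {1..k}"
  then obtain j' where j': "j' \<in> {1..k}" "\<phi> j = \<phi>' j'" using assms(5) by blast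
  have "j - 1 = j' - 1"
    using strict_mono_on_inv_card[OF assms(1) _ j, of n] strict_mono_on_inv_card[OF assms(2) _ j'(1), of n]
      assms(3,4,5) j'(2) by (simp add: PiE_def)
  with j j' show "\<phi> j = \<phi>' j" by (auto simp: eq_diff_iff)
qed

lemma ex_strict_mono_on_enumeration:
  fixes A :: "nat set"
  assumes "A \<subseteq> {1..n}" "card A = k"
  obtains \<phi> where "strict_mono_on {1..k} \<phi>" "\<phi> \<in> {1..k} \<rightarrow>\<^sub>E {1..n}" "\<phi> ` {1..k} = A"
proof -
  have "finite A" using assms(1) finite_subset by blast
  then obtain h where h: "bij_betw h {..<k} A" "strict_mono_on {..<k} h"
    using ex_bij_betw_strict_mono_card[of A] assms(2) by blast
  \<comment> \<open>\<open>h\<close> enumerates \<open>A\<close> from index 0, hence the shift by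
    one.\<close>
  define \<phi> where "\<phi> = restrict (\<lambda>j. h (j - 1)) {1..k}"
  have "(\<lambda>j. j - 1) ` {1..k} = {..<k}"
    by (auto simp: image_iff intro!: bexI[of _ "Suc _"])
  then have "h ` (\<lambda>j. j - 1) ` {1..k} = A"
    using bij_betw_imp_surj_on[OF h(1)] by simp
  then have im: "\<phi> ` {1..k} = A"
    by (simp add: \<phi>_def image_image)
  show ?thesis
  proof
    show "strict_mono_on {1..k} \<phi>"
      using strict_mono_onD[OF h(2)] by (auto intro!: strict_mono_onI simp: \<phi>_def)
    show "\<phi> \<in> {1..k} \<rightarrow>\<^sub>E {1..n}"
      using im assms(1) by (auto simp: \<phi>_def)
  qed (rule im)
qed

text \<open>A preimage of a pattern enumerates the positions of \<open>True\<close> and of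
  \<open>False\<close> in increasing order; uniqueness of such enumerations gives
  injectivity.\<close>

lemma bij_betw_pattern_of:
  "bij_betw (\<lambda>(\<phi>, \<psi>). pattern_of k l (\<phi> ` {1..k})) (I_set k l) (patterns k l)"
proof (rule bij_betw_imageI)
  show "inj_on (\<lambda>(\<phi>, \<psi>). pattern_of k l (\<phi> ` {1..k})) (I_set k l)"
  proof (rule inj_onI, clarify)
    fix \<phi> \<psi> \<phi>' \<psi>'
    assume I: "(\<phi>, \<psi>) \<in> I_set k l" and I': "(\<phi>', \<psi>') \<in> I_set k l"
      and "pattern_of k l (\<phi> ` {1..k}) = pattern_of k l (\<phi>' ` {1..k})"
    then have "\<forall>i\<in>{1..k + l}. i \<in> \<phi> ` {1..k} \<longleftrightarrow> i \<in> \<phi>' ` {1..k}"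
      by (auto simp: pattern_of_def simp del: upt_Suc)
    moreover have "\<phi> ` {1..k} \<subseteq> {1..k + l}" "\<phi>' ` {1..k} \<subseteq> {1..k + l}"
      using I_setD(3)[OF I] I_setD(3)[OF I'] by auto
    ultimately have eq: "\<phi> ` {1..k} = \<phi>' ` {1..k}" by blast
    then have "\<psi> ` {1..l} = \<psi>' ` {1..l}" using I_setD(5)[OF I] I_setD(5)[OF I'] by simp
    with eq show "\<phi> = \<phi>' \<and> \<psi> = \<psi>'"
      using strict_mono_on_eqI[OF I_setD(1)[OF I] I_setD(1)[OF I'] I_setD(3)[OF I] I_setD(3)[OF I']]
        strict_mono_on_eqI[OF I_setD(2)[OF I] I_setD(2)[OF I'] I_setD(4)[OF I] I_setD(4)[OF I']]
      by blast
  qed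
  show "(\<lambda>(\<phi>, \<psi>). pattern_of k l (\<phi> ` {1..k})) ` I_set k l = patterns k l"
  proof (intro equalityI subsetI)
    fix e assume e: "e \<in> patterns k l"
    define A where "A = {i \<in> {1..k + l}. e ! (i - 1)}"
    have eA: "e = pattern_of k l A"
      using length_pattern[OF e] by (auto simp: pattern_of_def A_def intro!: nth_equalityI simp del: upt_Suc)
    have "A \<subseteq> {1..k + l}" by (auto simp: A_def)
    moreover have "{i \<in> {1..k + l}. (i \<in> A) = True} = A" using \<open>A \<subseteq> {1..k + l}\<close> by auto
    ultimately have "card A = k"
      using e unfolding eA patterns_def pattern_of_def mem_Collect_eq count_list_map_upt by simp
    then have "card ({1..k + l} - A) = l"
      using \<open>A \<subseteq> {1..k + l}\<close> by (simp add: card_Diff_subset finite_subset[of A "{1..k + l}"])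
    obtain \<phi> where \<phi>: "strict_mono_on {1..k} \<phi>" "\<phi> \<in> {1..k} \<rightarrow>\<^sub>E {1..k + l}" "\<phi> ` {1..k} = A"
      using ex_strict_mono_on_enumeration[OF \<open>A \<subseteq> {1..k + l}\<close> \<open>card A = k\<close>] .
    obtain \<psi> where \<psi>: "strict_mono_on {1..l} \<psi>" "\<psi> \<in> {1..l} \<rightarrow>\<^sub>E {1..k + l}"
        "\<psi> ` {1..l} = {1..k + l} - A"
      using ex_strict_mono_on_enumeration[OF Diff_subset \<open>card ({1..k + l} - A) = l\<close>] .
    have "(\<phi>, \<psi>) \<in> I_set k l"
      using \<phi> \<psi> \<open>A \<subseteq> {1..k + l}\<close>
      by (auto simp: I_set_def strict_mono_on_imp_mono_on strict_mono_on_imp_inj_on)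
    then show "e \<in> (\<lambda>(\<phi>, \<psi>). pattern_of k l (\<phi> ` {1..k})) ` I_set k l"
      using \<phi>(3) eA by force
  qed (use pattern_of_I_set in auto)
qed

text \<open>The inverse reads a list as a function on \<open>{1..n}\<close>; \<open>restrict\<close>
  makes it extensional, as \<open>weight_set\<close> demands.\<close>

lemma bij_betw_weight_set:
  "bij_betw (\<lambda>t. map t [1..<Suc n]) (weight_set n m) (compositions n m)"
proof (rule bij_betw_byWitness[where f' = "\<lambda>ts. restrict (\<lambda>i. ts ! (i - 1)) {1..n}"])
  show "\<forall>t\<in>weight_set n m. restrict (\<lambda>i. map t [1..<Suc n] ! (i - 1)) {1..n} = t"
    by (auto simp: weight_set_def fun_eq_iff PiE_iff extensional_def simp del: upt_Suc)
  show "\<forall>ts\<in>compositions n m. map (restrict (\<lambda>i. ts ! (i - 1)) {1..n}) [1..<Suc n] = ts"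
    by (auto simp: compositions_def intro!: nth_equalityI simp del: upt_Suc)
  have sum: "sum_list (map t [1..<Suc n]) = (\<Sum>i=1..n. t i)" for t :: "nat \<Rightarrow> nat"
    by (simp add: sum_list_distinct_conv_sum_set atLeastLessThanSuc_atLeastAtMost del: upt_Suc)
  show "(\<lambda>t. map t [1..<Suc n]) ` weight_set n m \<subseteq> compositions n m"
    by (auto simp: weight_set_def compositions_def sum PiE_iff simp del: upt_Suc One_nat_def)
  show "(\<lambda>ts. restrict (\<lambda>i. ts ! (i - 1)) {1..n}) ` compositions n m \<subseteq> weight_set n m"
  proof (rule image_subsetI)
    fix ts assume ts: "ts \<in> compositions n m"
    have "(\<Sum>i=1..n. ts ! (i - 1)) = (\<Sum>i<n. ts ! i)"
      by (rule sum.reindex_bij_witness[of _ Suc "\<lambda>i. i - 1"]) auto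
    then have "(\<Sum>i=1..n. ts ! (i - 1)) = m"
      using ts by (auto simp: compositions_def sum_list_sum_nth atLeast0LessThan)
    moreover have "ts ! (i - 1) \<in> {1..}" if "i \<in> {1..n}" for i
    proof -
      have "i - 1 < length ts" using ts that by (auto simp: compositions_def)
      then have "ts ! (i - 1) \<in> set ts" by (rule nth_mem)
      with ts show ?thesis by (auto simp: compositions_def)
    qed
    then have "restrict (\<lambda>i. ts ! (i - 1)) {1..n} \<in> {1..n} \<rightarrow>\<^sub>E {1..}"
      by (intro restrict_PiE_iff[THEN iffD2] ballI)
    ultimately show "restrict (\<lambda>i. ts ! (i - 1)) {1..n} \<in> weight_set n m"
      unfolding weight_set_def by simp
  qed
qed

lemma shuffle_coeff_eq_pcoeff:
  assumes I: "(\<phi>, \<psi>) \<in> I_set k l" and t: "t \<in> {1..k + l} \<rightarrow> {1..}"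
  shows "shuffle_coeff k l r s t (\<phi>, \<psi>) =
    pcoeff (map (\<lambda>i. int (r i)) [1..<Suc k]) (map (\<lambda>i. int (s i)) [1..<Suc l])
      (pattern_of k l (\<phi> ` {1..k})) (map t [1..<Suc (k + l)])"
    (is "_ = pcoeff ?rs ?ss ?e ?ts")
proof -
  define A where "A = \<phi> ` {1..k}"
  define h where "h i = int (merge_vec k l (\<phi>, \<psi>) r s i)" for i
  have h_alt: "merge_vec k l (\<phi>, \<psi>) (\<lambda>i. int (r i)) (\<lambda>i. int (s i)) = h"
    by (auto simp: h_def merge_vec_def)
  have e: "?e \<in> patterns (length ?rs) (length ?ss)"
    using pattern_of_I_set[OF I] by (simp del: upt_Suc)
  have len: "length ?ts = length ?e" by (simp add: pattern_of_def del: upt_Suc)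
  have pos: "set ?ts \<subseteq> {1..}" using t by (auto simp del: upt_Suc)
  have zip: "zip ?e (zip (interleave ?e ?rs ?ss) ?ts) =
      map (\<lambda>i. (i \<in> A, h i, t i)) [1..<Suc (k + l)]"
    unfolding interleave_pattern_of[OF I] h_alt
    by (simp add: pattern_of_def A_def zip_map_map zip_same_conv_map o_def del: upt_Suc)
  \<comment> \<open>With \<open>x = 0\<close> neither word is lowered, so \<open>q\<close> may be
    either side. Choosing the side of position 1 gives the first factor the form prescribed for
    \<open>i = 1\<close>.\<close>
  have "pcoeff ?rs ?ss ?e ?ts =
      run_coeff (1 \<in> A) 0 (map (\<lambda>i. (i \<in> A, h i, t i)) [1..<Suc (k + l)])"
    using pcoeff_eq_run_coeff[OF e len pos, of 0] zip by (cases "1 \<in> A") (simp_all del: upt_Suc One_nat_def)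
  also have "\<dots> = shuffle_coeff k l r s t (\<phi>, \<psi>)"
    unfolding run_coeff_map_upt shuffle_coeff_def
  proof (rule prod.cong)
    fix i assume "i \<in> {1..k + l}"
    then show "(if (i \<in> A) = (if i = 1 then 1 \<in> A else i - 1 \<in> A) then binom (int (t i) - 1) (h i - 1)
        else binom (int (t i) - 1) (0 + (\<Sum>m = 1..i. int (t m)) - (\<Sum>m = 1..i. h m))) =
      coeff_factor k l r s t (\<phi>, \<psi>) i"
      by (auto simp: coeff_factor_def Let_def eps_def h_def A_def[symmetric] simp del: One_nat_def)
  qed simp
  finally show ?thesis by simp
qed

subsection \<open>The product \<open>shuffle_rho\<close>\<close>

lemma rho_linear:
  "finite I \<Longrightarrow> rho G (\<Sum>i\<in>I. f i) = (\<Sum>i\<in>I. rho G (f i))"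
  "rho G (frag_cmul c p) = frag_cmul c (rho G p)"
  by (simp_all add: rho_def frag_extend_sum frag_extend_cmul o_def)

lemma the_inv_into_rho_frag_of:
  assumes "w \<in> sH_words G"
  shows "the_inv_into (H1 G) (rho G) (frag_of w) = frag_of (xword w)"
proof (rule the_inv_into_f_eq)
  show "inj_on (rho G) (H1 G)" using bij_betw_rho bij_betw_imp_inj_on by blast
  show "rho G (frag_of (xword w)) = frag_of w" using assms by (rule rho_xword)
  show "frag_of (xword w) \<in> H1 G" using xword_in_H1_words[OF assms] by (simp add: H1_def)
qed

lemma word_eq_zip: "word n t c = zip (map t [1..<Suc n]) (map c [1..<Suc n])"
  by (simp add: word_def zip_map_map zip_same_conv_map del: upt_Suc)

lemma word_in_sH_words:
  "t \<in> {1..n} \<rightarrow> {1..} \<Longrightarrow> c \<in> {1..n} \<rightarrow> G \<Longrightarrow> word n t c \<in> sH_words G"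
  by (auto simp: word_def sH_words_def Pi_iff simp del: upt_Suc)

text \<open>The entries are read off the interleaved list, whose elements come from \<open>a\<close>
  and \<open>b\<close>.\<close>

lemma merge_vec_in_Pi:
  assumes I: "(\<phi>, \<psi>) \<in> I_set k l" and "a \<in> {1..k} \<rightarrow> G" "b \<in> {1..l} \<rightarrow> G"
  shows "merge_vec k l (\<phi>, \<psi>) a b \<in> {1..k + l} \<rightarrow> G"
proof -
  have "set (map (merge_vec k l (\<phi>, \<psi>) a b) [1..<Suc (k + l)]) \<subseteq> G"
    unfolding interleave_pattern_of[OF I, symmetric]
    by (rule order_trans[OF set_interleave]) (use assms in \<open>auto simp del: upt_Suc\<close>)
  then show ?thesis by (auto simp: image_subset_iff simp del: upt_Suc)
qed

theorem theorem2p1: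
  fixes G :: "'g set" and k l :: nat
    and r s :: "nat \<Rightarrow> nat" and a b :: "nat \<Rightarrow> 'g"
  assumes "k \<ge> 1" and "l \<ge> 1"
    and "r \<in> {1..k} \<rightarrow> {1..}" and "a \<in> {1..k} \<rightarrow> G"
    and "s \<in> {1..l} \<rightarrow> {1..}" and "b \<in> {1..l} \<rightarrow> G"
  shows "shuffle_rho G (frag_of (word k r a)) (frag_of (word l s b)) =
    (\<Sum>\<phi>\<psi>\<in>I_set k l. \<Sum>t\<in>weight_set (k + l) ((\<Sum>i=1..k. r i) + (\<Sum>i=1..l. s i)).
       frag_cmul (shuffle_coeff k l r s t \<phi>\<psi>)
         (frag_of (word (k + l) t (merge_vec k l \<phi>\<psi> a b))))"
proof -
  define m where "m = (\<Sum>i=1..k. r i) + (\<Sum>i=1..l. s i)"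
  let ?u = "word k r a" and ?v = "word l s b"
  let ?rs = "map (\<lambda>i. int (r i)) [1..<Suc k]" and ?ss = "map (\<lambda>i. int (s i)) [1..<Suc l]"
  let ?as = "map a [1..<Suc k]" and ?bs = "map b [1..<Suc l]"
  have mem: "?u \<in> sH_words G" "?v \<in> sH_words G"
    using assms by (simp_all add: word_in_sH_words)
  then have pos: "set ?u \<subseteq> {1..} \<times> UNIV" "set ?v \<subseteq> {1..} \<times> UNIV"
    by (auto simp: sH_words_def)
  have maps: "map (int \<circ> fst) (word n t c) = map (\<lambda>i. int (t i)) [1..<Suc n]"
    "map snd (word n t c) = map c [1..<Suc n]"
    "sum_list (map fst (word n t c)) = (\<Sum>i=1..n. t i)" for n t and c :: "nat \<Rightarrow> 'g"
    by (simp_all add: word_def o_def sum_list_distinct_conv_sum_set atLeastLessThanSuc_atLeastAtMost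
        del: upt_Suc)
  have "shuffle_rho G (frag_of ?u) (frag_of ?v) = rho G (shuffle_words (xword ?u) (xword ?v))"
    by (simp add: shuffle_rho_def the_inv_into_rho_frag_of mem shuffle_prod_def)
  also have "shuffle_words (xword ?u) (xword ?v) = block_expansion ?rs ?as ?ss ?bs m"
    using shuffle_words_xword[OF pos] by (simp only: maps m_def)
  also have "\<dots> = (\<Sum>e\<in>patterns k l. \<Sum>ts\<in>compositions (k + l) m.
      frag_cmul (pcoeff ?rs ?ss e ts) (frag_of (xword (zip ts (interleave e ?as ?bs)))))"
    by (simp add: block_expansion_def del: upt_Suc)
  also have "\<dots> = (\<Sum>\<phi>\<psi>\<in>I_set k l. \<Sum>t\<in>weight_set (k + l) m.
      frag_cmul (pcoeff ?rs ?ss (case \<phi>\<psi> of (\<phi>, \<psi>) \<Rightarrow> pattern_of k l (\<phi> ` {1..k})) (map t [1..<Suc (k + l)]))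
        (frag_of (xword (zip (map t [1..<Suc (k + l)])
          (interleave (case \<phi>\<psi> of (\<phi>, \<psi>) \<Rightarrow> pattern_of k l (\<phi> ` {1..k})) ?as ?bs)))))"
    unfolding sum.reindex_bij_betw[OF bij_betw_pattern_of, symmetric]
      sum.reindex_bij_betw[OF bij_betw_weight_set, symmetric] ..
  also have "\<dots> = (\<Sum>\<phi>\<psi>\<in>I_set k l. \<Sum>t\<in>weight_set (k + l) m.
      frag_cmul (shuffle_coeff k l r s t \<phi>\<psi>)
        (frag_of (xword (word (k + l) t (merge_vec k l \<phi>\<psi> a b)))))"
    by (intro sum.cong refl)
      (auto simp: shuffle_coeff_eq_pcoeff interleave_pattern_of word_eq_zip weight_set_def PiE_iff
        simp del: upt_Suc One_nat_def)
  also have "rho G \<dots> = (\<Sum>\<phi>\<psi>\<in>I_set k l. \<Sum>t\<in>weight_set (k + l) m.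
      frag_cmul (shuffle_coeff k l r s t \<phi>\<psi>)
        (rho G (frag_of (xword (word (k + l) t (merge_vec k l \<phi>\<psi> a b))))))"
    by (simp add: rho_linear finite_I_set finite_weight_set)
  also have "\<dots> = (\<Sum>\<phi>\<psi>\<in>I_set k l. \<Sum>t\<in>weight_set (k + l) m.
      frag_cmul (shuffle_coeff k l r s t \<phi>\<psi>)
        (frag_of (word (k + l) t (merge_vec k l \<phi>\<psi> a b))))"
  \<comment> \<open>\<open>rho\<close> inverts \<open>xword\<close> on \<open>sH_words G\<close>
    only, so each merged word must be shown to lie there.\<close>
  proof (intro sum.cong refl)
    fix \<phi>\<psi> t assume "\<phi>\<psi> \<in> I_set k l" "t \<in> weight_set (k + l) m"
    then have "word (k + l) t (merge_vec k l \<phi>\<psi> a b) \<in> sH_words G"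
      using assms(4,6) merge_vec_in_Pi[of "fst \<phi>\<psi>" "snd \<phi>\<psi>" k l a G b]
      by (intro word_in_sH_words) (simp_all add: weight_set_def PiE_def)
    then show "frag_cmul (shuffle_coeff k l r s t \<phi>\<psi>)
        (rho G (frag_of (xword (word (k + l) t (merge_vec k l \<phi>\<psi> a b))))) =
      frag_cmul (shuffle_coeff k l r s t \<phi>\<psi>)
        (frag_of (word (k + l) t (merge_vec k l \<phi>\<psi> a b)))"
      by (simp add: rho_xword)
  qed
  finally show ?thesis by (simp only: m_def)
qed

end
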